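(* Let $a=\langle T,\mathtt{w}(x)\rangle$, $b=\langle T,\mathtt{w}(y)\rangle$, $\bar a=\langle\bar T,\mathtt{w}(\bar x)\rangle$, $\bar b=\langle\bar T,\mathtt{w}(\bar y)\rangle$ be letters of $\Sigma$, for some distinct threads $T,\bar T\in\mathcal{T}$ and distinct memory locations $x,y,\bar x,\bar y\in\mathcal{X}$. Let $L$ be the regular language $L=(ab+\bar a\bar b)^*$. Let $R\subseteq\Sigma^*\times\Sigma^*$ be an arbitrary sound reordering relation such that $\equiv_{\mathcal{M}}\ \subseteq R$. Then any one-pass algorithm for membership in $\mathsf{Pre}_R(L)$ and in $\mathsf{Post}_R(L)$ must use linear space in the worst case. Further, the time $T(n)$ and space $S(n)$ usage of any multi-pass algorithm for solving this problem must satisfy $S(n)\cdot T(n)\in\Omega(n^2)$, where $n$ is the length of the input run.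
   Context: Given finite sets $\mathcal{T}$ (threads) and $\mathcal{X}$ (memory locations), let $\Sigma=\{\langle t,op(x)\rangle : t\in\mathcal{T},\ op\in\{\mathtt{w},\mathtt{r}\},\ x\in\mathcal{X}\}$ ($\mathtt{w}$ = write, $\mathtt{r}$ = read). A run is a finite word $\sigma\in\Sigma^*$; the occurrences of letters in it are its events. The reads-from map $\mathsf{rf}_\sigma$ is the partial map sending each read event on a location $x$ to the last write event on $x$ preceding it in $\sigma$, undefined if there is no such write. Reads-from equivalence: $\sigma\equiv_{\mathsf{rf}}\rho$ iff for every thread $t$ the subsequence of events of thread $t$ is the same in $\sigma$ and $\rho$ (same events and same program order; so the $j$-th event of thread $t$ in $\sigma$ is identified with the $j$-th event of thread $t$ in $\rho$), and, under this identification, $\mathsf{rf}_\sigma=\mathsf{rf}_\rho$. A (length-preserving) reordering relation $R\subseteq\Sigma^*\times\Sigma^*$ is sound iff $R\subseteq\ \equiv_{\mathsf{rf}}$. Trace equivalence $\equiv_{\mathcal{M}}$ is the smallest equivalence on $\Sigma^*$ such that $\tau_1\cdot e\cdot f\cdot\tau_2\equiv_{\mathcal{M}}\tau_1\cdot f\cdot e\cdot\tau_2$ whenever $(e,f)\in\mathbb{I}$, where $\mathbb{I}=\{(\langle t_1,op_1(x_1)\rangle,\langle t_2,op_2(x_2)\rangle) : t_1\neq t_2 \wedge (x_1=x_2\Rightarrow op_1=op_2=\mathtt{r})\}$. For $L\subseteq\Sigma^*$: $\mathsf{Pre}_R(L)=\{\sigma\in\Sigma^* : \exists\rho\in L,\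 (\sigma,\rho)\in R\}$ and $\mathsf{Post}_R(L)=\{\rho\in\Sigma^* : \exists\sigma\in L,\ (\sigma,\rho)\in R\}$. A one-pass algorithm reads the input run once from left to right; a multi-pass algorithm may make several such passes.
   Formalization: The language is corrected from L=(ab+āb̄)* to L=(aā+bb̄)*: for the printed L, Pre_R(L)=Post_R(L) is the shuffle of (ab)* and (āb̄)* for every admissible R, a regular language decidable in one pass with constant space. Worst case is over runs of length at most n. *)

theory Defs
  imports Complex_Main "HOL-Library.Landau_Symbols"
begin

section \<open>Runs, reads-from equivalence and trace equivalence\<close>

datatype access = W | R

instance access :: finite
proof
  have "(UNIV :: access set) \<subseteq> {W, R}"
    using access.exhaust by blast
  then show "finite (UNIV :: access set)"
    by (rule finite_subset) simp
qed

text \<open>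
  A letter \<open>(t, p, x)\<close> is an access of kind \<open>p\<close> by thread \<open>t\<close> to location \<open>x\<close>. Threads and
  locations are types of class \<open>finite\<close>, so the list type is all of \<open>\<Sigma>\<^sup>*\<close>.
\<close>

type_synonym ('t, 'x) letter = "'t \<times> access \<times> 'x"
type_synonym ('t, 'x) run = "('t, 'x) letter list"

abbreviation thread :: "('t, 'x) letter \<Rightarrow> 't" where
  "thread e \<equiv> fst e"

abbreviation kind :: "('t, 'x) letter \<Rightarrow> access" where
  "kind e \<equiv> fst (snd e)"

abbreviation loc :: "('t, 'x) letter \<Rightarrow> 'x" where
  "loc e \<equiv> snd (snd e)"

text \<open>The events of a run are its positions.\<close>

definition writes_before :: "('t, 'x) run \<Rightarrow> nat \<Rightarrow> nat set" where
  "writes_before \<sigma> i = {j. j < i \<and> kind (\<sigma> ! j) = W \<and> loc (\<sigma> ! j) = loc (\<sigma> ! i)}"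

definition reads_from :: "('t, 'x) run \<Rightarrow> nat \<rightharpoonup> nat" where
  "reads_from \<sigma> i =
     (if i < length \<sigma> \<and> kind (\<sigma> ! i) = R \<and> writes_before \<sigma> i \<noteq> {}
      then Some (Max (writes_before \<sigma> i)) else None)"

definition thread_proj :: "'t \<Rightarrow> ('t, 'x) run \<Rightarrow> ('t, 'x) run" where
  "thread_proj t \<sigma> = filter (\<lambda>e. thread e = t) \<sigma>"

text \<open>
  Position \<open>i\<close> carries the \<open>j\<close>-th event (counting from 0) of thread \<open>t\<close>, where
  \<open>event_id \<sigma> i = (t, j)\<close>. Events of different runs are identified when these names agree.
\<close>

definition event_id :: "('t, 'x) run \<Rightarrow> nat \<Rightarrow> 't \<times> nat" where
  "event_id \<sigma> i = (thread (\<sigma> ! i), card {k. k < i \<and> thread (\<sigma> ! k) = thread (\<sigma> ! i)})"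

text \<open>The graph of the reads-from map, in terms of the run-independent names of events.\<close>

definition rf_graph :: "('t, 'x) run \<Rightarrow> (('t \<times> nat) \<times> ('t \<times> nat)) set" where
  "rf_graph \<sigma> = {(event_id \<sigma> i, event_id \<sigma> j) | i j. reads_from \<sigma> i = Some j}"

definition rf_equiv :: "(('t, 'x) run \<times> ('t, 'x) run) set" where
  "rf_equiv = {(\<sigma>, \<rho>). (\<forall>t. thread_proj t \<sigma> = thread_proj t \<rho>) \<and> rf_graph \<sigma> = rf_graph \<rho>}"

definition length_preserving :: "(('t, 'x) run \<times> ('t, 'x) run) set \<Rightarrow> bool" where
  "length_preserving Rel \<longleftrightarrow> (\<forall>(\<sigma>, \<rho>) \<in> Rel. length \<sigma> = length \<rho>)"

definition sound :: "(('t, 'x) run \<times> ('t, 'x) run) set \<Rightarrow> bool" where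
  "sound Rel \<longleftrightarrow> Rel \<subseteq> rf_equiv"

definition indep :: "(('t, 'x) letter \<times> ('t, 'x) letter) set" where
  "indep = {(e, f). thread e \<noteq> thread f \<and> (loc e = loc f \<longrightarrow> kind e = R \<and> kind f = R)}"

inductive_set trace_equiv :: "(('t, 'x) run \<times> ('t, 'x) run) set" where
  swap: "(e, f) \<in> indep \<Longrightarrow> (\<tau>\<^sub>1 @ [e, f] @ \<tau>\<^sub>2, \<tau>\<^sub>1 @ [f, e] @ \<tau>\<^sub>2) \<in> trace_equiv"
| refl: "(\<sigma>, \<sigma>) \<in> trace_equiv"
| sym: "(\<sigma>, \<rho>) \<in> trace_equiv \<Longrightarrow> (\<rho>, \<sigma>) \<in> trace_equiv"
| trans: "(\<sigma>, \<rho>) \<in> trace_equiv \<Longrightarrow> (\<rho>, \<tau>) \<in> trace_equiv \<Longrightarrow> (\<sigma>, \<tau>) \<in> trace_equiv"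

definition Pre :: "(('t, 'x) run \<times> ('t, 'x) run) set \<Rightarrow> ('t, 'x) run set \<Rightarrow> ('t, 'x) run set" where
  "Pre Rel L = {\<sigma>. \<exists>\<rho>\<in>L. (\<sigma>, \<rho>) \<in> Rel}"

definition Post :: "(('t, 'x) run \<times> ('t, 'x) run) set \<Rightarrow> ('t, 'x) run set \<Rightarrow> ('t, 'x) run set" where
  "Post Rel L = {\<rho>. \<exists>\<sigma>\<in>L. (\<sigma>, \<rho>) \<in> Rel}"

definition star :: "'a list set \<Rightarrow> 'a list set" where
  "star A = concat ` lists A"


section \<open>One-pass and multi-pass algorithms\<close>

text \<open>
  A deterministic algorithm has a read-only input, scanned from left to right, and a working memory
  holding a bit string. In one step it sees its memory and the scanned letter (\<open>None\<close> at the end of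
  the input), and it halts with a verdict or replaces the memory and then keeps the head in place,
  advances it, or moves it back to the first letter, which starts a new pass.

  The step function is arbitrary and the head position is not charged as space, so finite control,
  work tapes and the registers of a random access machine can all be encoded in the memory. Lower
  bounds for this model therefore hold for every such concrete machine.
\<close>

type_synonym memory = "bool list"

datatype action = Halt bool | Stay memory | Advance memory | Rewind memory

datatype 'a algorithm =
  Algorithm (init: memory) (delta: "memory \<Rightarrow> 'a option \<Rightarrow> action")

datatype config = Active (head: nat) (mem: memory) | Halted bool

definition scanned :: "'a list \<Rightarrow> nat \<Rightarrow> 'a option" where
  "scanned w i = (if i < length w then Some (w ! i) else None)"

fun next_config :: "'a algorithm \<Rightarrow> 'a list \<Rightarrow> config \<Rightarrow> config" where
  "next_config A w (Active i m) =
     (case delta A m (scanned w i) of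
        Halt v \<Rightarrow> Halted v
      | Stay m' \<Rightarrow> Active i m'
      | Advance m' \<Rightarrow> Active (min (Suc i) (length w)) m'
      | Rewind m' \<Rightarrow> Active 0 m')"
| "next_config A w (Halted v) = Halted v"

definition config_after :: "'a algorithm \<Rightarrow> 'a list \<Rightarrow> nat \<Rightarrow> config" where
  "config_after A w k = (next_config A w ^^ k) (Active 0 (init A))"

definition decides :: "'a algorithm \<Rightarrow> 'a list set \<Rightarrow> bool" where
  "decides A Q \<longleftrightarrow> (\<forall>w. \<exists>k. config_after A w k = Halted (w \<in> Q))"

definition one_pass :: "'a algorithm \<Rightarrow> bool" where
  "one_pass A \<longleftrightarrow>
     (\<forall>w k i m m'. config_after A w k = Active i m \<longrightarrow> delta A m (scanned w i) \<noteq> Rewind m')"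

text \<open>
  The following four functions are meaningful for algorithms that halt on every input over a finite
  alphabet: only then are the minimum and the maxima taken over nonempty and finite sets, respectively.
\<close>

definition run_time :: "'a algorithm \<Rightarrow> 'a list \<Rightarrow> nat" where
  "run_time A w = (LEAST k. \<exists>v. config_after A w k = Halted v)"

definition run_space :: "'a algorithm \<Rightarrow> 'a list \<Rightarrow> nat" where
  "run_space A w = Max {length m | k i m. config_after A w k = Active i m}"

text \<open>
  Worst-case usage at \<open>n\<close> is the maximum over the inputs of length at most \<open>n\<close>. With inputs of
  length exactly \<open>n\<close> no lower bound for all large \<open>n\<close> could hold for a language whose words
  all have even length, as the parity of the length is found in one pass with constant memory.
\<close>

definition time_usage :: "'a::finite algorithm \<Rightarrow> nat \<Rightarrow> nat" where
  "time_usage A n = Max (run_time A ` {w. length w \<le> n})"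

definition space_usage :: "'a::finite algorithm \<Rightarrow> nat \<Rightarrow> nat" where
  "space_usage A n = Max (run_space A ` {w. length w \<le> n})"

end

theory Submission
  imports Defs "HOL-Library.Sublist"
begin

text \<open>
  Let \<open>u\<close> be a word over \<open>{a, b}\<close> and \<open>v\<close> the barred copy of such a word. Soundness preserves the
  thread projections, and \<open>a\<close>, \<open>b\<close> commute with their barred copies, so \<open>u @ v\<close> is a member iff \<open>v\<close> is
  the copy of \<open>u\<close>: membership contains the equality problem.
  For the lower bounds, record the configurations in which the head crosses the middle of the input.
  If the accepting runs on two equality instances had the same crossing sequence, they could be
  cut and pasted into an accepting run on a mixed word. Hence there are at least \<open>2 ^ m\<close> crossing
  sequences for words of length \<open>2 * m\<close>. With space \<open>s\<close> and \<open>r\<close> crossings there are at most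
  \<open>2 ^ ((s + 2) * r)\<close> of them, and since the head can only return to the left half by a rewind,
  \<open>r\<close> crossings take time at least \<open>m * r / 2\<close>.
\<close>

section \<open>Crossing sequences\<close>

text \<open>Halting steps do not count, so the verdict is not part of a crossing sequence.\<close>

definition crosses :: "nat \<Rightarrow> config \<Rightarrow> config \<Rightarrow> bool" where
  "crosses m c c' \<longleftrightarrow>
     (\<exists>i \<mu> i' \<mu>'. c = Active i \<mu> \<and> c' = Active i' \<mu>' \<and> (i < m) \<noteq> (i' < m))"

text \<open>Each entry is the configuration entered by the crossing, which is all that one half of
  the input learns about the other.\<close>

primrec crossings :: "nat \<Rightarrow> (nat \<Rightarrow> config) \<Rightarrow> nat \<Rightarrow> config list" where
  "crossings m c 0 = []"
| "crossings m c (Suc k) =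
     crossings m c k @ (if crosses m (c k) (c (Suc k)) then [c (Suc k)] else [])"

lemma crosses_simps [simp]:
  "crosses m (Active i \<mu>) (Active i' \<mu>') \<longleftrightarrow> (i < m) \<noteq> (i' < m)"
  "\<not> crosses m (Halted v) c"
  "\<not> crosses m c (Halted v)"
  by (auto simp: crosses_def)

lemma config_after_0 [simp]: "config_after A w 0 = Active 0 (init A)"
  by (simp add: config_after_def)

lemma config_after_Suc:
  "config_after A w (Suc k) = next_config A w (config_after A w k)"
  by (simp add: config_after_def)

lemma config_after_halted:
  assumes "config_after A w k = Halted v" and "k \<le> l"
  shows "config_after A w l = Halted v"
  using assms(2,1) by (induction l rule: dec_induct) (auto simp: config_after_Suc)

lemma crossings_mono: "k \<le> l \<Longrightarrow> prefix (crossings m c k) (crossings m c l)"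
proof (induction l rule: dec_induct)
  case base
  then show ?case by simp
next
  case (step n)
  then show ?case by (auto intro: prefix_prefix)
qed

lemma crossings_prefix_halted:
  assumes "config_after A w K = Halted v"
  shows "prefix (crossings m (config_after A w) k) (crossings m (config_after A w) K)"
proof (cases "k \<le> K")
  case True
  then show ?thesis by (rule crossings_mono)
next
  case False
  then have "K \<le> k" by simp
  then have "crossings m (config_after A w) k = crossings m (config_after A w) K"
  proof (induction k rule: dec_induct)
    case (step n)
    then show ?case using config_after_halted[OF assms, of n] by simp
  qed simp
  then show ?thesis by simp
qed

text \<open>At most one entry is added per step, so at the moment the prefix becomes complete the
  run has just crossed into \<open>e\<close>.\<close>

lemma prefix_crossings_attained:
  assumes "prefix (xs @ [e]) (crossings m c K)"
  shows "\<exists>k. crossings m c k = xs @ [e] \<and> c k = e"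
  using assms
proof (induction K)
  case 0
  then show ?case by simp
next
  case (Suc K)
  show ?case
  proof (cases "prefix (xs @ [e]) (crossings m c K)")
    case True
    then show ?thesis by (rule Suc.IH)
  next
    case False
    with Suc.prems have "crossings m c (Suc K) = xs @ [e] \<and> c (Suc K) = e"
      by (auto split: if_splits)
    then show ?thesis by blast
  qed
qed

section \<open>Cutting and pasting two accepting runs\<close>

lemma next_config_cong:
  assumes "scanned w i = scanned w' i" and "length w = length w'"
  shows "next_config A w (Active i \<mu>) = next_config A w' (Active i \<mu>)"
  using assms by (simp split: action.splits)

text \<open>
  The step of the mixed run \<open>d\<close> in the cut-and-paste argument: \<open>c\<close> is the run that \<open>d\<close> currently follows
  and \<open>c'\<close> the one that owns the other half. If the step crosses the middle, then \<open>c'\<close> also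
  reaches the new configuration, so that either run can be followed from there.
\<close>

lemma cut_and_paste_step:
  assumes eq: "crossings m c k = crossings m c' k'" and pre: "prefix (crossings m c (Suc k)) (crossings m c' K')"
    and cross: "crosses m (c k) (c (Suc k))"
  shows "\<exists>l'. crossings m c (Suc k) = crossings m c' l' \<and> c' l' = c (Suc k)"
proof -
  have "crossings m c (Suc k) = crossings m c k @ [c (Suc k)]"
    using cross by simp
  with pre show ?thesis
    using prefix_crossings_attained[of "crossings m c k" "c (Suc k)" m c' K'] by metis
qed

text \<open>The run on \<open>u @ v'\<close> copies the run on \<open>u @ v\<close> while the head
  is left of \<open>m\<close>, and the run on \<open>u' @ v'\<close> otherwise. Equal crossing
  sequences let it change over at each crossing, so it can halt only by copying an accepting
  step.\<close>

lemma cut_and_paste: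
  assumes len: "length u = m" "length u' = m" "length v = length v'"
    and m: "0 < m"
    and acc: "config_after A (u @ v) K = Halted True"
      "config_after A (u' @ v') K' = Halted True"
    and eq: "crossings m (config_after A (u @ v)) K = crossings m (config_after A (u' @ v')) K'"
    and halt: "config_after A (u @ v') t = Halted b"
  shows b
proof -
  define c where "c = config_after A (u @ v)"
  define c' where "c' = config_after A (u' @ v')"
  define d where "d = config_after A (u @ v')"
  have left: "next_config A (u @ v') (Active i \<mu>) = next_config A (u @ v) (Active i \<mu>)"
    if "i < m" for i \<mu>
    using that len by (intro next_config_cong) (auto simp: scanned_def nth_append)
  have right: "next_config A (u @ v') (Active i \<mu>) = next_config A (u' @ v') (Active i \<mu>)"
    if "\<not> i < m" for i \<mu>
    using that len by (intro next_config_cong) (auto simp: scanned_def nth_append)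
  have pre: "prefix (crossings m c k) (crossings m c' K')"
    "prefix (crossings m c' k) (crossings m c K)" for k
    using crossings_prefix_halted[OF acc(1), of m k] crossings_prefix_halted[OF acc(2), of m k] eq
    by (auto simp: c_def c'_def)
  have c_halt: h if "c k = Halted h" for k h
    using config_after_halted[OF acc(1), of "max k K"]
      config_after_halted[of A "u @ v" k h "max k K"] that
    by (simp add: c_def)
  have c'_halt: h if "c' k = Halted h" for k h
    using config_after_halted[OF acc(2), of "max k K'"]
      config_after_halted[of A "u' @ v'" k h "max k K'"] that
    by (simp add: c'_def)
  \<comment> \<open>The invariant: after equal crossings, the run that owns the current half is in
    configuration \<open>e\<close>. The other run may be anywhere, and \<open>k\<close>,
    \<open>k'\<close> need not equal the time \<open>t\<close> of the mixed run.\<close>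
  define follows where "follows e \<longleftrightarrow> (case e of Halted h \<Rightarrow> h
      | Active i \<mu> \<Rightarrow> \<exists>k k'. crossings m c k = crossings m c' k' \<and>
          (if i < m then c k = e else c' k' = e))" for e
  have follow_left: "follows (Active i \<mu>)"
    if "crossings m c k = crossings m c' k'" "c k = Active i \<mu>" "i < m" for k k' i \<mu>
    using that by (auto simp: follows_def)
  have follow_right: "follows (Active i \<mu>)"
    if "crossings m c k = crossings m c' k'" "c' k' = Active i \<mu>" "\<not> i < m" for k k' i \<mu>
    using that by (auto simp: follows_def)
  have "follows (d t)"
  proof (induction t)
    case 0
    show ?case
      using m follow_left[of 0 0 0 "init A"] by (simp add: c_def d_def)
  next
    case (Suc t)
    show ?case
    proof (cases "d t")
      case (Halted h)
      then show ?thesis using Suc by (simp add: d_def config_after_Suc)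
    next
      case (Active i \<mu>)
      with Suc obtain k k' where kk: "crossings m c k = crossings m c' k'"
        and e: "if i < m then c k = d t else c' k' = d t"
        by (auto simp: follows_def)
      show ?thesis
      proof (cases "i < m")
        case True
        then have ck: "c k = Active i \<mu>" using e Active by simp
        have dS: "d (Suc t) = c (Suc k)"
          using left[OF True, of \<mu>] ck Active by (simp add: c_def d_def config_after_Suc)
        show ?thesis
        proof (cases "d (Suc t)")
          case (Halted h)
          then show ?thesis using dS c_halt by (simp add: follows_def)
        next
          case dA: (Active j \<nu>)
          note cS = dA[unfolded dS]
          \<comment> \<open>Inside the left half only \<open>k\<close> advances. On a crossing,
            \<open>k'\<close> moves to a time \<open>l\<close> at which the other run is in the same
            configuration after the same crossings.\<close>
          show ?thesis
          proof (cases "j < m")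
            case True
            with \<open>i < m\<close> ck cS have "crossings m c (Suc k) = crossings m c' k'"
              by (simp add: kk)
            from follow_left[OF this cS True] show ?thesis by (simp add: dA)
          next
            case False
            with \<open>i < m\<close> ck cS have "crosses m (c k) (c (Suc k))" by simp
            from cut_and_paste_step[OF kk pre(1) this] obtain l where
              "crossings m c (Suc k) = crossings m c' l" "c' l = c (Suc k)" by blast
            from follow_right[OF this(1) this(2)[unfolded cS] False] show ?thesis by (simp add: dA)
          qed
        qed
      next
        case False
        then have ck: "c' k' = Active i \<mu>" using e Active by simp
        have dS: "d (Suc t) = c' (Suc k')"
          using right[OF False, of \<mu>] ck Active by (simp add: c'_def d_def config_after_Suc)
        show ?thesis
        proof (cases "d (Suc t)")
          case (Halted h)
          then show ?thesis using dS c'_halt by (simp add: follows_def)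
        next
          case dA: (Active j \<nu>)
          note cS = dA[unfolded dS]
          show ?thesis
          proof (cases "j < m")
            case False
            with \<open>\<not> i < m\<close> ck cS have "crossings m c k = crossings m c' (Suc k')"
              by (simp add: kk)
            from follow_right[OF this cS False] show ?thesis by (simp add: dA)
          next
            case True
            with \<open>\<not> i < m\<close> ck cS have "crosses m (c' k') (c' (Suc k'))" by simp
            from cut_and_paste_step[OF kk[symmetric] pre(2) this] obtain l where
              "crossings m c' (Suc k') = crossings m c l" "c l = c' (Suc k')" by blast
            from follow_left[OF this(1)[symmetric] this(2)[unfolded cS] True] show ?thesis
              by (simp add: dA)
          qed
        qed
      qed
    qed
  qed
  then show b using halt by (simp add: follows_def d_def)
qed

section \<open>Number and form of the crossings\<close>

lemma crossings_length_time:
  assumes "0 < m" and "m \<le> length w"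
  shows "m * length (crossings m (config_after A w) k) \<le> 2 * k"
proof -
  let ?r = "\<lambda>k. length (crossings m (config_after A w) k)"
  \<comment> \<open>Amortised count with income 2 per step and price \<open>m\<close> per crossing.
    On reaching position \<open>m\<close> the head has saved \<open>2 * m\<close>: half pays for
    this crossing, half is kept for the return by a rewind to 0.\<close>
  have "m * ?r k + (case config_after A w k of
      Active i \<mu> \<Rightarrow> if i < m then 2 * i else m | Halted v \<Rightarrow> 0) \<le> 2 * k"
  proof (induction k)
    case 0
    then show ?case using assms by simp
  next
    case (Suc k)
    show ?case
    proof (cases "config_after A w k")
      case (Halted v)
      then show ?thesis using Suc by (simp add: config_after_Suc)
    next
      case (Active i \<mu>)
      then have IH: "m * ?r k + (if i < m then 2 * i else m) \<le> 2 * k"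
        using Suc by simp
      show ?thesis
      proof (cases "config_after A w (Suc k)")
        case (Halted v)
        then show ?thesis using IH by simp
      next
        case next': (Active j \<nu>)
        then have "j = i \<or> j = min (Suc i) (length w) \<or> j = 0"
          using Active by (auto simp: config_after_Suc split: action.splits)
        then have "i < m \<and> j < m \<and> j \<le> Suc i \<or> i < m \<and> j = m \<and> m = Suc i \<or>
            m \<le> i \<and> (j = 0 \<or> m \<le> j)"
          using assms by auto
        then show ?thesis using IH next' Active by (auto simp: distrib_left)
      qed
    qed
  qed
  then show ?thesis by linarith
qed

lemma config_after_run_time:
  assumes "decides A Q"
  shows "config_after A w (run_time A w) = Halted (w \<in> Q)"
proof -
  obtain k where k: "config_after A w k = Halted (w \<in> Q)"
    using assms unfolding decides_def by blast
  then obtain v where v: "config_after A w (run_time A w) = Halted v"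
    unfolding run_time_def using LeastI[of "\<lambda>k. \<exists>v. config_after A w k = Halted v"] by blast
  have "run_time A w \<le> k"
    unfolding run_time_def using k by (intro Least_le) blast
  from config_after_halted[OF v this] show ?thesis
    using k v by simp
qed

text \<open>Stated for a single input, so that it serves both one-pass algorithms and runs that use
  no memory.\<close>

definition rewinds :: "'a algorithm \<Rightarrow> 'a list \<Rightarrow> bool" where
  "rewinds A w \<longleftrightarrow>
     (\<exists>k i \<mu> \<mu>'. config_after A w k = Active i \<mu> \<and> delta A \<mu> (scanned w i) = Rewind \<mu>')"

text \<open>Without rewinds the head never moves left, so it cannot come back across the
  middle.\<close>

lemma crossings_length_no_rewind:
  assumes "0 < m" and "m \<le> length w" and "\<not> rewinds A w"
  shows "length (crossings m (config_after A w) k) \<le> 1"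
proof -
  have "case config_after A w k of
      Active i \<mu> \<Rightarrow> length (crossings m (config_after A w) k) \<le> (if i < m then 0 else 1)
    | Halted v \<Rightarrow> length (crossings m (config_after A w) k) \<le> 1"
  proof (induction k)
    case 0
    then show ?case using assms by simp
  next
    case (Suc k)
    show ?case
    proof (cases "config_after A w k")
      case (Halted v)
      then show ?thesis using Suc by (simp add: config_after_Suc)
    next
      case (Active i \<mu>)
      then have "delta A \<mu> (scanned w i) \<noteq> Rewind \<mu>'" for \<mu>'
        using assms(3) by (auto simp: rewinds_def)
      then show ?thesis using Suc Active assms(1,2)
        by (auto simp: config_after_Suc min_def split: action.splits if_splits)
    qed
  qed
  then show ?thesis by (auto split: config.splits if_splits)
qed

text \<open>An advance crosses exactly onto \<open>m\<close> and a rewind onto 0. Hence the head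
  position, which is not charged as space, contributes only a factor 2.\<close>

lemma set_crossings:
  assumes "m \<le> length w"
    and space: "\<And>k i \<mu>. config_after A w k = Active i \<mu> \<Longrightarrow> length \<mu> \<le> s"
  shows "set (crossings m (config_after A w) k)
           \<subseteq> case_prod Active ` ({0, m} \<times> {\<mu>. length \<mu> \<le> s})"
proof (induction k)
  case 0
  then show ?case by simp
next
  case (Suc k)
  have "config_after A w (Suc k) \<in> case_prod Active ` ({0, m} \<times> {\<mu>. length \<mu> \<le> s})"
    if cross: "crosses m (config_after A w k) (config_after A w (Suc k))"
  proof -
    obtain i \<mu> i' \<mu>' where *: "config_after A w k = Active i \<mu>"
      "config_after A w (Suc k) = Active i' \<mu>'" "(i < m) \<noteq> (i' < m)"
      using cross by (auto simp: crosses_def)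
    have "i' \<in> {0, m}"
      using * assms(1) by (auto simp: config_after_Suc min_def split: action.splits if_splits)
    then show ?thesis using *(2) space[OF *(2)] by auto
  qed
  then show ?case using Suc by auto
qed

section \<open>Counting crossing sequences\<close>

lemma sum_power_le_Suc_power: "(\<Sum>i\<le>r. q ^ i) \<le> (Suc q) ^ r" for q r :: nat
proof (induction r)
  case 0
  then show ?case by simp
next
  case (Suc r)
  have "q * q ^ r \<le> q * Suc q ^ r"
    by (intro mult_left_mono power_mono) auto
  with Suc show ?case by (simp add: add_mono)
qed

text \<open>Shorter lists are in effect padded to length \<open>r\<close> by one extra symbol; the
  strict bound on \<open>card E\<close> leaves room for it.\<close>

lemma card_lists_length_le_power:
  assumes "finite E" and "card E < 2 ^ p"
  shows "card {xs. set xs \<subseteq> E \<and> length xs \<le> r} \<le> 2 ^ (p * r)"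
proof -
  have "card {xs. set xs \<subseteq> E \<and> length xs \<le> r} \<le> Suc (card E) ^ r"
    using assms(1) by (simp add: card_lists_length_le sum_power_le_Suc_power)
  also have "\<dots> \<le> (2 ^ p) ^ r"
    using assms(2) by (intro power_mono) auto
  finally show ?thesis by (simp add: power_mult)
qed

lemma finite_memories: "finite {\<mu> :: memory. length \<mu> \<le> s}"
  using finite_lists_length_le[of "UNIV :: bool set" s] by simp

lemma card_memories: "card {\<mu> :: memory. length \<mu> \<le> s} < 2 ^ Suc s"
proof -
  have "card {\<mu> :: memory. length \<mu> \<le> s} = (\<Sum>i\<le>s. 2 ^ i)"
    using card_lists_length_le[of "UNIV :: bool set" s] by simp
  also have "\<dots> < 2 ^ Suc s"
    by (induction s) auto
  finally show ?thesis .
qed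

text \<open>The \<open>2 ^ m\<close> words \<open>map f u @ map g u\<close> need distinct crossing
  sequences: a collision would make the algorithm accept \<open>map f u @ map g v\<close> with
  \<open>u\<close> and \<open>v\<close> different.\<close>

lemma equality_crossings_bound:
  fixes f g :: "bool \<Rightarrow> 'a"
  assumes dec: "decides A Q"
    and fool: "\<And>u v. length u = m \<Longrightarrow> length v = m \<Longrightarrow> map f u @ map g v \<in> Q \<longleftrightarrow> u = v"
    and m: "0 < m"
    and space: "\<And>w k i \<mu>. length w = 2 * m \<Longrightarrow> config_after A w k = Active i \<mu> \<Longrightarrow> length \<mu> \<le> s"
    and cross: "\<And>w. length w = 2 * m \<Longrightarrow>
      length (crossings m (config_after A w) (run_time A w)) \<le> r"
  shows "m \<le> (s + 2) * r"
proof -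
  let ?E = "case_prod Active ` ({0, m} \<times> {\<mu> :: memory. length \<mu> \<le> s})"
  let ?w = "\<lambda>u. map f u @ map g u"
  let ?C = "\<lambda>u. crossings m (config_after A (?w u)) (run_time A (?w u))"
  have fin: "finite ?E" using finite_memories by auto
  \<comment> \<open>Of the \<open>s + 2\<close> bits, one is for the position and
    \<open>s + 1\<close> are for the memory.\<close>
  have "card ?E \<le> card ({0, m} \<times> {\<mu> :: memory. length \<mu> \<le> s})"
    using finite_memories by (intro card_image_le) auto
  also have "\<dots> = 2 * card {\<mu> :: memory. length \<mu> \<le> s}"
    using m by (simp add: card_cartesian_product)
  also have "\<dots> < 2 ^ (s + 2)"
    using card_memories[of s] by simp
  finally have card: "card ?E < 2 ^ (s + 2)" .
  have acc: "config_after A (?w u) (run_time A (?w u)) = Halted True" if u: "length u = m" for u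
    using config_after_run_time[OF dec, of "?w u"] fool[OF u u] by simp
  have "inj_on ?C {u. length u = m}"
  proof (rule inj_onI, rule ccontr)
    fix u v assume uv: "u \<in> {u. length u = m}" "v \<in> {u. length u = m}" "?C u = ?C v" "u \<noteq> v"
    then have "map f u @ map g v \<notin> Q" using fool by simp
    then have "config_after A (map f u @ map g v) (run_time A (map f u @ map g v)) = Halted False"
      using config_after_run_time[OF dec] by simp
    from cut_and_paste[OF _ _ _ m acc acc uv(3) this] uv show False by simp
  qed
  moreover have "?C ` {u. length u = m} \<subseteq> {xs. set xs \<subseteq> ?E \<and> length xs \<le> r}"
  proof (intro subsetI; elim imageE; simp only: mem_Collect_eq; intro conjI)
    fix u :: "bool list" assume u: "length u = m"
    show "set (?C u) \<subseteq> ?E"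
      using u by (intro set_crossings) (auto intro!: space[of "?w u"])
    show "length (?C u) \<le> r"
      using u by (intro cross) auto
  qed
  moreover have "finite {xs. set xs \<subseteq> ?E \<and> length xs \<le> r}"
    using fin by (rule finite_lists_length_le)
  ultimately have "card {u :: bool list. length u = m} \<le> card {xs. set xs \<subseteq> ?E \<and> length xs \<le> r}"
    by (rule card_inj_on_le)
  also have "\<dots> \<le> 2 ^ ((s + 2) * r)"
    by (rule card_lists_length_le_power[OF fin card])
  finally have "(2 :: nat) ^ m \<le> 2 ^ ((s + 2) * r)"
    using card_lists_length_eq[of "UNIV :: bool set" m] by simp
  then show ?thesis by simp
qed

section \<open>Lower bounds for the equality problem\<close>

lemma run_time_le:
  fixes A :: "'a::finite algorithm"
  assumes "length w \<le> n"
  shows "run_time A w \<le> time_usage A n"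
  unfolding time_usage_def
  using assms finite_lists_length_le[of "UNIV :: 'a set" n] by (intro Max_ge) auto

text \<open>A halting run has finitely many active configurations, so the \<open>Max\<close> in
  \<open>run_space\<close> is a genuine upper bound.\<close>

lemma memory_le_space_usage:
  fixes A :: "'a::finite algorithm"
  assumes "decides A Q" and "length w \<le> n" and act: "config_after A w k = Active i \<mu>"
  shows "length \<mu> \<le> space_usage A n"
proof -
  note halt = config_after_run_time[OF assms(1), of w]
  have "{length m | k i m. config_after A w k = Active i m}
      \<subseteq> (\<lambda>k. length (mem (config_after A w k))) ` {..<run_time A w}"
  proof clarify
    fix k i m assume *: "config_after A w k = Active i m"
    with config_after_halted[OF halt, of k] have "k < run_time A w" by fastforce
    with * show "length m \<in> (\<lambda>k. length (mem (config_after A w k))) ` {..<run_time A w}"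
      by (auto intro!: image_eqI[of _ _ k])
  qed
  then have "finite {length m | k i m. config_after A w k = Active i m}"
    by (rule finite_subset) simp
  then have "length \<mu> \<le> run_space A w"
    unfolding run_space_def using act by (intro Max_ge) auto
  also have "\<dots> \<le> space_usage A n"
    unfolding space_usage_def
    using assms(2) finite_lists_length_le[of "UNIV :: 'a set" n] by (intro Max_ge) auto
  finally show ?thesis .
qed

text \<open>With no memory, a rewind leads back to the initial configuration.\<close>

lemma no_space_no_rewind:
  assumes "decides A Q" and "\<And>k i \<mu>. config_after A w k = Active i \<mu> \<Longrightarrow> \<mu> = []"
  shows "\<not> rewinds A w"
proof
  assume "rewinds A w"
  then obtain k i \<mu> \<mu>' where
    k: "config_after A w k = Active i \<mu>" "delta A \<mu> (scanned w i) = Rewind \<mu>'"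
    by (auto simp: rewinds_def)
  then have S: "config_after A w (Suc k) = Active 0 \<mu>'"
    by (simp add: config_after_Suc)
  then have loop: "config_after A w (Suc k) = config_after A w 0"
    using assms(2)[OF S] assms(2)[of 0 0 "init A"] by simp
  note halt = config_after_run_time[OF assms(1), of w]
  have less: "Suc k < run_time A w"
    using config_after_halted[OF halt, of "Suc k"] S by fastforce
  \<comment> \<open>Restarting at time \<open>Suc k\<close> repeats the run from the beginning, so
    it would already have halted at time \<open>l\<close>, before its least halting time.\<close>
  define l where "l = run_time A w - Suc k"
  have "config_after A w (l + Suc k) = config_after A w l"
    using loop unfolding config_after_def funpow_add by simp
  then have "config_after A w l = Halted (w \<in> Q)"
    using halt less by (simp add: l_def)
  then have "run_time A w \<le> l"
    unfolding run_time_def by (intro Least_le) blast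
  with less show False by (simp add: l_def)
qed

text \<open>The counting bound is used for inputs of length \<open>2 * m\<close> with
  \<open>m = n div 2\<close>: the number of crossings is at most 1 in one pass, and at most
  \<open>2 * t div m\<close> within time \<open>t\<close>.\<close>

lemma equality_lower_bounds:
  fixes f g :: "bool \<Rightarrow> 'a::finite"
  assumes dec: "decides A Q"
    and fool: "\<And>u v. length u = length v \<Longrightarrow> map f u @ map g v \<in> Q \<longleftrightarrow> u = v"
  shows "one_pass A \<Longrightarrow> (\<lambda>n. real (space_usage A n)) \<in> \<Omega>(\<lambda>n. real n)"
    and "(\<lambda>n. real (space_usage A n) * real (time_usage A n)) \<in> \<Omega>(\<lambda>n. (real n)\<^sup>2)"
proof -
  have bound: "m \<le> (space_usage A n + 2) * r"
    if "0 < m" "2 * m \<le> n"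
      and "\<And>w. length w = 2 * m \<Longrightarrow> length (crossings m (config_after A w) (run_time A w)) \<le> r"
    for m n r
  proof (rule equality_crossings_bound[OF dec fool that(1) _ that(3)])
    fix w k i \<mu> assume "length w = 2 * m" "config_after A w k = Active i \<mu>"
    then show "length \<mu> \<le> space_usage A n"
      using memory_le_space_usage[OF dec, of w n k i \<mu>] that(2) by simp
  qed auto
  have no_rewind: "m \<le> space_usage A n + 2"
    if "0 < m" "2 * m \<le> n" "\<And>w. length w = 2 * m \<Longrightarrow> \<not> rewinds A w" for m n
  proof -
    have "length (crossings m (config_after A w) (run_time A w)) \<le> 1" if "length w = 2 * m" for w
      using \<open>0 < m\<close> that \<open>\<And>w. length w = 2 * m \<Longrightarrow> \<not> rewinds A w\<close>
      by (intro crossings_length_no_rewind) auto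
    from bound[OF \<open>0 < m\<close> \<open>2 * m \<le> n\<close> this] show ?thesis by simp
  qed
  \<comment> \<open>Positive space absorbs the additive 2 of the counting bound. Half length 3 is
    the least that contradicts \<open>m \<le> 0 + 2\<close>, whence the threshold 6.\<close>
  have pos: "0 < space_usage A n" if "6 \<le> n" for n
  proof (rule ccontr)
    assume 0: "\<not> 0 < space_usage A n"
    have "\<not> rewinds A w" if "length w = 2 * 3" for w
      using memory_le_space_usage[OF dec, of w n] that \<open>6 \<le> n\<close> 0
      by (intro no_space_no_rewind[OF dec]) fastforce
    from no_rewind[of 3 n, OF _ _ this] 0 \<open>6 \<le> n\<close> show False by simp
  qed
  {
    assume "one_pass A"
    then have nr: "\<not> rewinds A w" for w
      by (auto simp: one_pass_def rewinds_def)
    \<comment> \<open>With \<open>s\<close> the space,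
      \<open>n \<le> 2 * (s + 2) + 1 \<le> 7 * s\<close>.\<close>
    have "n \<le> 7 * space_usage A n" if "6 \<le> n" for n
      using no_rewind[of "n div 2" n, OF _ _ nr] pos[OF that] that by linarith
    then have "1 / 7 * real n \<le> real (space_usage A n)" if "6 \<le> n" for n
      using that by (simp add: field_simps flip: of_nat_mult) (metis of_nat_le_iff of_nat_mult of_nat_numeral)
    then show "(\<lambda>n. real (space_usage A n)) \<in> \<Omega>(\<lambda>n. real n)"
      by (intro landau_omega.bigI[of "1 / 7"]) (auto simp: eventually_at_top_linorder)
  }
  \<comment> \<open>The constant is \<open>9 * 6\<close>: \<open>n \<le> 3 * m\<close> gives 9, and
    \<open>s + 2 \<le> 3 * s\<close> with at most \<open>2 * t div m\<close> crossings gives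
    6.\<close>
  have "n\<^sup>2 \<le> 54 * (space_usage A n * time_usage A n)" if n: "6 \<le> n" for n
  proof -
    define m where "m = n div 2"
    define s where "s = space_usage A n"
    define t where "t = time_usage A n"
    have m: "0 < m" "2 * m \<le> n" "n \<le> 3 * m" using n by (auto simp: m_def)
    have "length (crossings m (config_after A w) (run_time A w)) \<le> 2 * t div m"
      if w: "length w = 2 * m" for w
    proof -
      have "m * length (crossings m (config_after A w) (run_time A w)) \<le> 2 * run_time A w"
        using m w by (intro crossings_length_time) auto
      also have "\<dots> \<le> 2 * t"
        using run_time_le[of w n A] m w by (simp add: t_def)
      finally show ?thesis
        using m by (simp add: less_eq_div_iff_mult_less_eq mult.commute)
    qed
    from bound[OF m(1,2) this] have "m \<le> (s + 2) * (2 * t div m)" by (simp add: s_def)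
    also have "\<dots> \<le> (3 * s) * (2 * t div m)"
      using pos[OF n] by (intro mult_right_mono) (auto simp: s_def)
    finally have "m * m \<le> (3 * s) * (2 * t div m) * m" by simp
    also have "\<dots> \<le> (3 * s) * (2 * t)"
      by (metis div_times_less_eq_dividend mult.assoc mult_le_mono2)
    finally have "m * m \<le> 6 * (s * t)" by simp
    moreover have "n\<^sup>2 \<le> 9 * (m * m)"
      using mult_le_mono[OF m(3) m(3)] by (simp add: power2_eq_square)
    ultimately show ?thesis by (simp add: s_def t_def)
  qed
  then have "1 / 54 * (real n)\<^sup>2 \<le> real (space_usage A n) * real (time_usage A n)" if "6 \<le> n" for n
    using that by (simp add: field_simps) (metis of_nat_le_iff of_nat_mult of_nat_numeral of_nat_power)
  then show "(\<lambda>n. real (space_usage A n) * real (time_usage A n)) \<in> \<Omega>(\<lambda>n. (real n)\<^sup>2)"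
    by (intro landau_omega.bigI[of "1 / 54"]) (auto simp: eventually_at_top_linorder abs_mult)
qed

section \<open>Reduction from equality\<close>

lemma trace_equiv_Cons:
  "(\<sigma>, \<rho>) \<in> trace_equiv \<Longrightarrow> (e # \<sigma>, e # \<rho>) \<in> trace_equiv"
proof (induction rule: trace_equiv.induct)
  case (swap e' f \<tau>\<^sub>1 \<tau>\<^sub>2)
  then show ?case using trace_equiv.swap[of e' f "e # \<tau>\<^sub>1" \<tau>\<^sub>2] by simp
qed (auto intro: trace_equiv.intros)

lemma trace_equiv_move_front:
  assumes "\<forall>e\<in>set \<sigma>. (e, f) \<in> indep"
  shows "(\<sigma> @ f # \<tau>, f # \<sigma> @ \<tau>) \<in> trace_equiv"
  using assms
proof (induction \<sigma>)
  case Nil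
  then show ?case by (simp add: trace_equiv.refl)
next
  case (Cons e \<sigma>)
  then have "(e # \<sigma> @ f # \<tau>, e # f # \<sigma> @ \<tau>) \<in> trace_equiv"
    by (intro trace_equiv_Cons) auto
  moreover have "(e # f # \<sigma> @ \<tau>, f # e # \<sigma> @ \<tau>) \<in> trace_equiv"
    using trace_equiv.swap[of e f "[]" "\<sigma> @ \<tau>"] Cons.prems by simp
  ultimately show ?case by (auto intro: trace_equiv.trans)
qed

text \<open>The first letter of the second block moves left past the rest of the first block to its
  partner; then induction. This makes equality instances members.\<close>

lemma trace_equiv_shuffle:
  assumes "\<And>c d. (f c, g d) \<in> indep"
  shows "(map f u @ map g u, concat (map (\<lambda>c. [f c, g c]) u)) \<in> trace_equiv"
proof (induction u)
  case Nil
  then show ?case by (simp add: trace_equiv.refl)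
next
  case (Cons c u)
  have "(map f u @ g c # map g u, g c # map f u @ map g u) \<in> trace_equiv"
    using assms by (intro trace_equiv_move_front) auto
  then show ?case
    using Cons by (auto intro: trace_equiv.trans trace_equiv_Cons)
qed

lemma thread_proj_concat_pairs:
  assumes "\<And>c. thread (f c) = T" "\<And>c. thread (g c) = T'" "T \<noteq> T'"
  shows "thread_proj T (concat (map (\<lambda>c. [f c, g c]) u)) = map f u"
    and "thread_proj T' (concat (map (\<lambda>c. [f c, g c]) u)) = map g u"
  using assms by (induction u) (auto simp: thread_proj_def)

lemma star_pairs:
  "star {[f True, g True], [f False, g False]} = range (\<lambda>u. concat (map (\<lambda>c. [f c, g c]) u))"
proof -
  have "{[f True, g True], [f False, g False]} = range (\<lambda>c. [f c, g c])"
    by (auto simp: UNIV_bool)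
  then have "lists {[f True, g True], [f False, g False]} = range (map (\<lambda>c. [f c, g c]))"
    by (simp add: lists_image)
  then show ?thesis by (simp add: star_def image_image)
qed

text \<open>The two thread projections recover \<open>map f u\<close> and \<open>map g v\<close>,
  while those of a word in the star come from one common bit word \<open>z\<close>.\<close>

lemma threads_determine_shuffle:
  assumes thr: "\<And>c. thread (f c) = T" "\<And>c. thread (g c) = T'" "T \<noteq> T'"
    and inj: "inj f" "inj g"
    and \<rho>: "\<rho> \<in> star {[f True, g True], [f False, g False]}"
    and eq: "\<forall>t. thread_proj t (map f u @ map g v) = thread_proj t \<rho>"
  shows "u = v"
proof -
  obtain z where z: "\<rho> = concat (map (\<lambda>c. [f c, g c]) z)"
    using \<rho> by (auto simp: star_pairs)
  have "thread_proj T (map f u @ map g v) = map f u" "thread_proj T' (map f u @ map g v) = map g v"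
    using thr by (auto simp: thread_proj_def filter_map o_def)
  then have "map f u = map f z" "map g v = map g z"
    using eq thread_proj_concat_pairs[of f T g T' z, OF thr] by (auto simp: z)
  then show ?thesis using inj by simp
qed

theorem theorem9p5:
  fixes T Tbar :: "'t::finite"
    and x y xbar ybar :: "'x::finite"
    and a b abar bbar :: "('t, 'x) letter"
    and L :: "('t, 'x) run set"
    and Rel :: "(('t, 'x) run \<times> ('t, 'x) run) set"
  assumes "T \<noteq> Tbar"
    and "distinct [x, y, xbar, ybar]"
    and "a = (T, W, x)" and "b = (T, W, y)"
    and "abar = (Tbar, W, xbar)" and "bbar = (Tbar, W, ybar)"
    and "L = star {[a, abar], [b, bbar]}"
    and "length_preserving Rel"
    and "sound Rel"
    and "trace_equiv \<subseteq> Rel"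
  shows "\<forall>Q \<in> {Pre Rel L, Post Rel L}.
           (\<forall>A. one_pass A \<and> decides A Q \<longrightarrow>
              (\<lambda>n. real (space_usage A n)) \<in> \<Omega>(\<lambda>n. real n)) \<and>
           (\<forall>A. decides A Q \<longrightarrow>
              (\<lambda>n. real (space_usage A n) * real (time_usage A n)) \<in> \<Omega>(\<lambda>n. (real n)\<^sup>2))"
proof -
  define f where "f c = (if c then a else b)" for c
  define g where "g c = (if c then abar else bbar)" for c
  have L: "L = star {[f True, g True], [f False, g False]}"
    using assms(7) by (simp add: f_def g_def)
  have thr: "thread (f c) = T" "thread (g c) = Tbar" for c
    using assms(3-6) by (auto simp: f_def g_def)
  have inj: "inj f" "inj g"
    using assms(2-6) by (auto simp: f_def g_def inj_def)
  have ind: "(f c, g d) \<in> indep" for c d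
    using assms(1-6) by (auto simp: f_def g_def indep_def)
  \<comment> \<open>Equality of projections is symmetric, so both orientations of
    \<open>Rel\<close>, and hence \<open>Pre\<close> and \<open>Post\<close>, are covered
    together.\<close>
  have eq: "u = v" if "(map f u @ map g v, \<rho>) \<in> Rel \<or> (\<rho>, map f u @ map g v) \<in> Rel" "\<rho> \<in> L" for u v \<rho>
    using that assms(9) thr
    by (intro threads_determine_shuffle[OF thr assms(1) inj, of \<rho>])
      (auto simp: L sound_def rf_equiv_def)
  have mem: "map f u @ map g u \<in> Pre Rel L" "map f u @ map g u \<in> Post Rel L" for u
  proof -
    have "(map f u @ map g u, concat (map (\<lambda>c. [f c, g c]) u)) \<in> trace_equiv"
      using ind by (rule trace_equiv_shuffle)
    then have "(map f u @ map g u, concat (map (\<lambda>c. [f c, g c]) u)) \<in> Rel"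
      "(concat (map (\<lambda>c. [f c, g c]) u), map f u @ map g u) \<in> Rel"
      using assms(10) trace_equiv.sym by blast+
    moreover have "concat (map (\<lambda>c. [f c, g c]) u) \<in> L"
      by (simp add: L star_pairs)
    ultimately show "map f u @ map g u \<in> Pre Rel L" "map f u @ map g u \<in> Post Rel L"
      by (auto simp: Pre_def Post_def)
  qed
  have fool: "map f u @ map g v \<in> Q \<longleftrightarrow> u = v" if "Q \<in> {Pre Rel L, Post Rel L}" for Q u v
    using that mem[of u] eq[of u v] by (auto simp: Pre_def Post_def)
  show ?thesis
    using equality_lower_bounds[of _ _ f g, OF _ fool] by blast
qed

end
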